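(* Let $d\in\mathbb{N}$, let $\Xi\subset\mathbb{R}^d$ be finite and symmetric, and let $\alpha\in\mathbb{N}^d$. (a) The infimum in the primal optimization problem, $$\inf\{\|\phi\|_1 \mid \phi \text{ a finite-support signed measure on }\mathbb{R}^d\text{ with }\phi*g=\partial^\alpha g\text{ for all }g\in\mathscr{K}_\Xi\},$$ is equal to the maximum in the dual optimization problem, $$\max\{(-\partial)^\alpha f(0)\mid f\in\mathscr{K}_\Xi,\ \|f\|_\infty\le 1\}.$$ (b) If $\phi^\star$ is a finite feasible shift rule that is an optimal solution of the primal optimization problem, then there exists a dual feasible $f$ (i.e., $f\in\mathscr{K}_\Xi$ with $\|f\|_\infty\le1$) such that $\|\phi^\star\|_1=(-\partial)^\alpha f(0)$.
   Context: $\mathbb{N}=\{1,2,3,\dots\}$. A set $\Xi\subset\mathbb{R}^d$ is symmetric if $\Xi=-\Xi$. $\mathscr{K}_\Xi$ denotes the real vector space of functions $f\colon\mathbb{R}^d\to\mathbb{R}$ of the form $f(x)=\sum_{\xi\in\Xi}b_\xi e^{2\pi i\,\xi\bullet x}$ with $b\in\mathbb{C}^\Xi$, $b_{-\xi}=\overline{b_\xi}$, where $\xi\bullet x=\sum_j\xi_jx_j$. $\|f\|_\infty=\sup_x|f(x)|$. $\partial^\alpha=\prod_j\partial_j^{\alpha_j}$ and $(-\partial)^\alpha=(-1)^{|\alpha|}\partial^\alpha$ with $|\alpha|=\sum_j\alpha_j$. A (finite) shift rule is a real signed measure of finite support $\phi=\sum_{a\in A}u_a\delta_a$, with $A\subset\mathbb{R}^d$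 finite and $u\in\mathbb{R}^A$; it acts by $(\phi*f)(x)=\sum_{a\in A}u_af(x-a)$. Its cost is $\|\phi\|_1=\sum_{a\in A}|u_a|$. It is feasible for $\Xi,\alpha$ if $\phi*g=\partial^\alpha g$ for all $g\in\mathscr{K}_\Xi$. An optimal solution of the primal problem is a finite feasible shift rule whose cost equals the infimum of the costs of all finite feasible shift rules. *)

theory Defs
  imports "HOL-Analysis.Analysis" "HOL-Library.Poly_Mapping"
begin

definition symmetric_set :: "(real ^ 'd) set \<Rightarrow> bool" where
  "symmetric_set \<Xi> \<longleftrightarrow> \<Xi> = uminus ` \<Xi>"

text \<open>Coefficients outside the (symmetric) set of frequencies play no role.\<close>

definition trig_space :: "(real ^ 'd) set \<Rightarrow> (real ^ 'd \<Rightarrow> real) set" where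
  "trig_space \<Xi> = {f. \<exists>b :: real ^ 'd \<Rightarrow> complex.
      (\<forall>\<xi>\<in>\<Xi>. b (- \<xi>) = cnj (b \<xi>)) \<and>
      (\<forall>x. complex_of_real (f x)
             = (\<Sum>\<xi>\<in>\<Xi>. b \<xi> * exp (2 * complex_of_real pi * \<i> * complex_of_real (\<xi> \<bullet> x))))}"

text \<open>The supremum norm is taken in the extended reals, so it is \<open>\<infinity>\<close> for unbounded functions.\<close>

definition sup_norm :: "(real ^ 'd \<Rightarrow> real) \<Rightarrow> ereal" where
  "sup_norm f = (SUP x. ereal \<bar>f x\<bar>)"

definition partial_deriv :: "'d \<Rightarrow> (real ^ 'd \<Rightarrow> real) \<Rightarrow> real ^ 'd \<Rightarrow> real" where
  "partial_deriv j f = (\<lambda>x. deriv (\<lambda>t. f (x + t *\<^sub>R axis j 1)) 0)"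

text \<open>The linear order on the finite index type plays the role of the order on
  \<open>{1, \<dots>, d}\<close>: the operators are composed in index order, that of the least index being
  applied last. On smooth functions the order is immaterial.\<close>

definition multi_deriv ::
    "nat ^ 'd::{finite,linorder} \<Rightarrow> (real ^ 'd::{finite,linorder} \<Rightarrow> real)
      \<Rightarrow> real ^ 'd::{finite,linorder} \<Rightarrow> real" where
  "multi_deriv \<alpha> f =
     foldr (\<lambda>j. partial_deriv j ^^ (\<alpha> $ j)) (sorted_list_of_set (UNIV :: 'd set)) f"

definition neg_multi_deriv ::
    "nat ^ 'd::{finite,linorder} \<Rightarrow> (real ^ 'd::{finite,linorder} \<Rightarrow> real)
      \<Rightarrow> real ^ 'd::{finite,linorder} \<Rightarrow> real" where
  "neg_multi_deriv \<alpha> f = (\<lambda>x. (- 1) ^ (\<Sum>j\<in>UNIV. \<alpha> $ j) * multi_deriv \<alpha> f x)"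

text \<open>A finite-support real signed measure \<open>\<Sum>a\<in>A. u a \<cdot> \<delta>\<^sub>a\<close> is represented by the finitely
  supported function giving its point masses; \<^const>\<open>Poly_Mapping.keys\<close> is its support.\<close>

type_synonym 'd shift_rule = "(real ^ 'd) \<Rightarrow>\<^sub>0 real"

definition shift_conv ::
    "'d shift_rule \<Rightarrow> (real ^ 'd \<Rightarrow> real) \<Rightarrow> real ^ 'd \<Rightarrow> real" where
  "shift_conv \<phi> f = (\<lambda>x. \<Sum>a\<in>Poly_Mapping.keys \<phi>. Poly_Mapping.lookup \<phi> a * f (x - a))"

definition shift_cost :: "'d shift_rule \<Rightarrow> real" where
  "shift_cost \<phi> = (\<Sum>a\<in>Poly_Mapping.keys \<phi>. \<bar>Poly_Mapping.lookup \<phi> a\<bar>)"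

definition primal_feasible ::
    "(real ^ 'd::{finite,linorder}) set \<Rightarrow> nat ^ 'd::{finite,linorder}
      \<Rightarrow> 'd::{finite,linorder} shift_rule set" where
  "primal_feasible \<Xi> \<alpha> = {\<phi>. \<forall>g\<in>trig_space \<Xi>. shift_conv \<phi> g = multi_deriv \<alpha> g}"

text \<open>The infimum is taken in the extended reals, so it is \<open>\<infinity>\<close> if no feasible rule exists.\<close>

definition primal_value ::
    "(real ^ 'd::{finite,linorder}) set \<Rightarrow> nat ^ 'd::{finite,linorder} \<Rightarrow> ereal" where
  "primal_value \<Xi> \<alpha> = (INF \<phi>\<in>primal_feasible \<Xi> \<alpha>. ereal (shift_cost \<phi>))"

definition primal_optimal ::
    "(real ^ 'd::{finite,linorder}) set \<Rightarrow> nat ^ 'd::{finite,linorder}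
      \<Rightarrow> 'd::{finite,linorder} shift_rule \<Rightarrow> bool" where
  "primal_optimal \<Xi> \<alpha> \<phi> \<longleftrightarrow>
     \<phi> \<in> primal_feasible \<Xi> \<alpha> \<and> ereal (shift_cost \<phi>) = primal_value \<Xi> \<alpha>"

definition dual_feasible :: "(real ^ 'd) set \<Rightarrow> (real ^ 'd \<Rightarrow> real) set" where
  "dual_feasible \<Xi> = {f \<in> trig_space \<Xi>. sup_norm f \<le> 1}"

definition is_maximum :: "real set \<Rightarrow> real \<Rightarrow> bool" where
  "is_maximum S m \<longleftrightarrow> m \<in> S \<and> (\<forall>v\<in>S. v \<le> m)"

end

(* Evaluating phi * g = d^alpha g at x amounts to pairing phi with the reflected translate
   y |-> g(x - y), and the space of trigonometric polynomials is closed under such maps. So phi is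
   feasible iff it represents the functional f |-> (-d)^alpha f(0) on that space, and the feasible
   rules form a coset phi_0 + N in the space of finitely supported measures with the 1-norm, where
   N is the annihilator of the trigonometric polynomials. The primal value is the distance of phi_0
   to N. As N has finite codimension, an elementary Hahn-Banach argument gives a functional of norm
   at most 1 that vanishes on N and attains this distance at phi_0. Its values at the Dirac measures
   form a function bounded by 1, and since it is annihilated by N, this function is a trigonometric
   polynomial: it is the dual optimum, and it serves for every optimal shift rule. *)
theory Submission imports Defs "HOL-Analysis.Finite_Function_Topology" begin

section \<open>Hahn--Banach for subspaces of finite codimension\<close>

definition sublinear :: "('a::real_vector \<Rightarrow> real) \<Rightarrow> bool" where
  "sublinear p \<longleftrightarrow> (\<forall>x y. p (x + y) \<le> p x + p y) \<and> (\<forall>c x. 0 \<le> c \<longrightarrow> p (c *\<^sub>R x) = c * p x)"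

lemma sublinearD:
  assumes "sublinear p"
  shows sublinear_add: "p (x + y) \<le> p x + p y"
    and sublinear_scaleR: "0 \<le> c \<Longrightarrow> p (c *\<^sub>R x) = c * p x"
    and sublinear_zero: "p 0 = 0"
proof -
  show "p (x + y) \<le> p x + p y" and "0 \<le> c \<Longrightarrow> p (c *\<^sub>R x) = c * p x"
    using assms unfolding sublinear_def by blast+
  show "p 0 = 0"
    using assms unfolding sublinear_def by (metis mult_zero_left order_refl scaleR_zero_left)
qed

lemma sublinear_minus_le:
  assumes "sublinear p"
  shows "- p (- x) \<le> p x"
  using sublinear_add[OF assms, of x "- x"] sublinear_zero[OF assms] by simp

text \<open>One step of Hahn-Banach, carried out by lowering a sublinear functional rather than by
  extending a linear one: the value at \<open>y\<close> is kept, and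
  \<open>- p (- y) \<le> p y\<close> is tightened to an equality for \<open>q\<close>.\<close>

lemma sublinear_shrink:
  fixes p :: "'a::real_vector \<Rightarrow> real"
  assumes p: "sublinear p"
  obtains q where "sublinear q" "\<And>x. q x \<le> p x" "q y = p y" "q (- y) = - p y"
proof -
  define g where "g x t = p (x + t *\<^sub>R y) - t * p y" for x t
  \<comment> \<open>The largest sublinear functional below \<open>p\<close> whose value at \<open>- y\<close> is at most \<open>- p y\<close>.\<close>
  define q where "q x = (INF t\<in>{0..}. g x t)" for x
  \<comment> \<open>A bound independent of \<open>t\<close>: it makes the real infimum defining
    \<open>q\<close> meaningful.\<close>
  have lower: "- p (- x) \<le> g x t" if "0 \<le> t" for x t
  proof -
    have "p (t *\<^sub>R y) \<le> p (x + t *\<^sub>R y) + p (- x)"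
      using sublinear_add[OF p, of "x + t *\<^sub>R y" "- x"] by simp
    then show ?thesis
      using sublinear_scaleR[OF p that, of y] by (simp add: g_def)
  qed
  have bdd: "bdd_below (g x ` {0..})" for x
    using lower by (intro bdd_belowI[of _ "- p (- x)"]) auto
  have q_le: "q x \<le> g x t" if "0 \<le> t" for x t
    unfolding q_def using bdd that by (intro cINF_lower) auto
  have q_ge: "m \<le> q x" if "\<And>t. 0 \<le> t \<Longrightarrow> m \<le> g x t" for m x
    unfolding q_def using that by (intro cINF_greatest) auto
  have q_p: "q x \<le> p x" for x
    using q_le[of 0 x] by (simp add: g_def)
  have "sublinear q"
    unfolding sublinear_def
  proof (intro conjI allI impI)
    fix x x'
    have split: "q (x + x') \<le> g x s + g x' t" if "0 \<le> s" "0 \<le> t" for s t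
    proof -
      have "q (x + x') \<le> g (x + x') (s + t)"
        using that by (intro q_le) simp
      also have "\<dots> \<le> g x s + g x' t"
        using sublinear_add[OF p, of "x + s *\<^sub>R y" "x' + t *\<^sub>R y"]
        by (simp add: g_def algebra_simps)
      finally show ?thesis .
    qed
    \<comment> \<open>In \<open>split\<close>, \<open>s\<close> and \<open>t\<close> are
      independent, so the two infima can be taken one after the other.\<close>
    have "q (x + x') - g x' t \<le> q x" if "0 \<le> t" for t
      using split that by (intro q_ge) (simp add: algebra_simps)
    then have "q (x + x') - q x \<le> q x'"
      by (intro q_ge) (simp add: algebra_simps)
    then show "q (x + x') \<le> q x + q x'" by simp
  next
    fix c :: real and x
    assume "0 \<le> c"
    \<comment> \<open>Only one inequality is needed for all \<open>c > 0\<close>; the reverse one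
      comes from scaling back by \<open>inverse c\<close>.\<close>
    have scale: "q (c *\<^sub>R x) \<le> c * q x" if "0 < c" for c x
    proof -
      have "q (c *\<^sub>R x) / c \<le> q x"
      proof (rule q_ge)
        fix t :: real
        assume "0 \<le> t"
        then have "q (c *\<^sub>R x) \<le> g (c *\<^sub>R x) (c * t)"
          using that by (intro q_le) simp
        also have "\<dots> = c * g x t"
          using sublinear_scaleR[OF p, of c "x + t *\<^sub>R y"] that
          by (simp add: g_def algebra_simps)
        finally show "q (c *\<^sub>R x) / c \<le> g x t"
          using that by (simp add: field_simps)
      qed
      then show ?thesis using that by (simp add: field_simps)
    qed
    have "q 0 = 0"
    proof (rule antisym)
      show "q 0 \<le> 0"
        using q_p[of 0] sublinear_zero[OF p] by simp
      show "0 \<le> q 0"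
        using lower[of _ 0] sublinear_zero[OF p] by (intro q_ge) simp
    qed
    then show "q (c *\<^sub>R x) = c * q x"
    proof (cases "c = 0")
      case False
      then have "0 < c" using \<open>0 \<le> c\<close> by simp
      have "q (inverse c *\<^sub>R (c *\<^sub>R x)) \<le> inverse c * q (c *\<^sub>R x)"
        using \<open>0 < c\<close> by (intro scale) simp
      then have "c * q x \<le> q (c *\<^sub>R x)"
        using \<open>0 < c\<close> by (simp add: field_simps)
      then show ?thesis
        using scale[OF \<open>0 < c\<close>, of x] by simp
    qed simp
  qed
  \<comment> \<open>Together with \<open>q y \<le> p y\<close>, the two bounds that follow force
    equality at both \<open>y\<close> and \<open>- y\<close>.\<close>
  moreover have "q (- y) \<le> - p y"
    using q_le[of 1 "- y"] sublinear_zero[OF p] by (simp add: g_def)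
  moreover have "- q (- y) \<le> q y"
    using \<open>sublinear q\<close> by (rule sublinear_minus_le)
  ultimately show ?thesis
    using that[of q] q_p q_p[of y] by force
qed

text \<open>Oddness at \<open>b\<close> survives further lowering: if \<open>r \<le> q\<close> is
  sublinear, then \<open>- q (- b) \<le> - r (- b) \<le> r b \<le> q b\<close>, and the outer terms
  agree. The elements of \<open>B\<close> can therefore be treated one at a time.\<close>

lemma sublinear_shrink_finite:
  fixes p :: "'a::real_vector \<Rightarrow> real"
  assumes "finite B" "sublinear p"
  shows "\<exists>q. sublinear q \<and> (\<forall>x. q x \<le> p x) \<and> (\<forall>b\<in>B. q (- b) = - q b)"
  using assms
proof (induction B rule: finite_induct)
  case empty
  then show ?case by auto
next
  case (insert y B)
  then obtain q where q: "sublinear q" "\<And>x. q x \<le> p x" "\<And>b. b \<in> B \<Longrightarrow> q (- b) = - q b"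
    by blast
  obtain r where r: "sublinear r" "\<And>x. r x \<le> q x" "r y = q y" "r (- y) = - q y"
    using sublinear_shrink[OF q(1)] by blast
  have "r (- b) = - r b" if "b \<in> B" for b
    using r(2)[of b] r(2)[of "- b"] q(3)[OF that] sublinear_minus_le[OF r(1), of b] by linarith
  moreover have "r x \<le> p x" for x
    using r(2) q(2) order_trans by blast
  moreover have "r (- y) = - r y"
    using r(3,4) by simp
  ultimately show ?case
    using r(1) by blast
qed

text \<open>By oddness, subadditivity at \<open>- x\<close> and \<open>- y\<close> is
  superadditivity at \<open>x\<close> and \<open>y\<close>.\<close>

lemma linear_if_sublinear_odd:
  assumes "sublinear q" "\<And>x. q (- x) = - q x"
  shows "linear q"
proof (rule linearI)
  show "q (x + y) = q x + q y" for x y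
    using sublinear_add[OF assms(1), of x y] sublinear_add[OF assms(1), of "- x" "- y"]
      assms(2)[of x] assms(2)[of y] assms(2)[of "x + y"] by simp
  show "q (c *\<^sub>R x) = c *\<^sub>R q x" for c x
  proof (cases "0 \<le> c")
    case True
    then show ?thesis by (simp add: sublinear_scaleR[OF assms(1)])
  next
    case False
    then show ?thesis
      using sublinear_scaleR[OF assms(1), of "- c" x] assms(2)[of "c *\<^sub>R x"] by simp
  qed
qed

text \<open>For \<open>x\<close>, \<open>y\<close> in the set, \<open>q (x + y)\<close> and
  \<open>q (- x - y)\<close> are bounded above by opposite numbers, while their sum is at least 0.
  Oddness thus has to be checked only on a spanning set.\<close>

lemma subspace_sublinear_odd:
  assumes "sublinear q"
  shows "subspace {x. q (- x) = - q x}"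
proof (rule subspaceI)
  show "0 \<in> {x. q (- x) = - q x}"
    using sublinear_zero[OF assms] by simp
next
  fix x y
  assume "x \<in> {x. q (- x) = - q x}" "y \<in> {x. q (- x) = - q x}"
  then show "x + y \<in> {x. q (- x) = - q x}"
    using sublinear_add[OF assms, of x y] sublinear_add[OF assms, of "- x" "- y"]
      sublinear_minus_le[OF assms, of "x + y"] by simp
next
  fix c x
  assume "x \<in> {x. q (- x) = - q x}"
  then show "c *\<^sub>R x \<in> {x. q (- x) = - q x}"
    using sublinear_scaleR[OF assms, of c x] sublinear_scaleR[OF assms, of c "- x"]
      sublinear_scaleR[OF assms, of "- c" x] sublinear_scaleR[OF assms, of "- c" "- x"]
    by (cases "0 \<le> c") auto
qed

text \<open>Lowering \<open>p\<close> first at \<open>z\<close> and then at the finitely many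
  elements of \<open>B\<close> suffices: on \<open>N\<close> oddness is inherited from
  \<open>p\<close>, and from \<open>N \<union> B\<close> it spreads to the whole space.\<close>

lemma hahn_banach_finite_codim:
  fixes p :: "'a::real_vector \<Rightarrow> real"
  assumes p: "sublinear p" and N: "\<And>x. x \<in> N \<Longrightarrow> p (- x) = - p x"
    and B: "finite B" "span (N \<union> B) = UNIV"
  obtains q where "linear q" "\<And>x. q x \<le> p x" "q z = p z"
proof -
  obtain r where r: "sublinear r" "\<And>x. r x \<le> p x" "r z = p z" "r (- z) = - p z"
    using sublinear_shrink[OF p] by blast
  obtain q where q: "sublinear q" "\<And>x. q x \<le> r x" "\<And>b. b \<in> B \<Longrightarrow> q (- b) = - q b"
    using sublinear_shrink_finite[OF B(1) r(1)] by blast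
  have qp: "q x \<le> p x" for x
    using q(2) r(2) order_trans by blast
  have "q (- x) = - q x" if "x \<in> N" for x
    using qp[of x] qp[of "- x"] N[OF that] sublinear_minus_le[OF q(1), of x] by linarith
  then have "N \<union> B \<subseteq> {x. q (- x) = - q x}"
    using q(3) by auto
  then have "span (N \<union> B) \<subseteq> {x. q (- x) = - q x}"
    by (rule span_minimal) (rule subspace_sublinear_odd[OF q(1)])
  then have "linear q"
    using q(1) B(2) by (intro linear_if_sublinear_odd) auto
  \<comment> \<open>The later lowering at \<open>B\<close> cannot spoil the value at
    \<open>z\<close>: \<open>q (- z) \<le> r (- z) = - p z\<close> forces
    \<open>q z \<ge> p z\<close>.\<close>
  moreover have "q z = p z"
    using qp[of z] q(2)[of "- z"] r(4) sublinear_minus_le[OF q(1), of z] by linarith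
  ultimately show ?thesis
    using that qp by blast
qed

section \<open>The distance to a subspace as a sublinear functional\<close>

lemma sublinear_infdist:
  fixes N :: "'a::real_normed_vector set"
  assumes N: "subspace N"
  shows "sublinear (\<lambda>x. infdist x N)"
proof -
  have ne: "N \<noteq> {}" using subspace_0[OF N] by blast
  have ge: "m \<le> infdist x N" if "\<And>a. a \<in> N \<Longrightarrow> m \<le> dist x a" for m x
    unfolding infdist_notempty[OF ne] using that ne by (intro cINF_greatest) auto
  have add: "infdist (x + y) N \<le> infdist x N + infdist y N" for x y
  proof -
    have split: "infdist (x + y) N \<le> dist x a + dist y b" if "a \<in> N" "b \<in> N" for a b
      using that N by (intro infdist_le2[of "a + b"]) (auto simp: subspace_add dist_triangle_add)
    have "infdist (x + y) N - dist y b \<le> infdist x N" if "b \<in> N" for b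
      using split that by (intro ge) (simp add: algebra_simps)
    then have "infdist (x + y) N - infdist x N \<le> infdist y N"
      by (intro ge) (simp add: algebra_simps)
    then show ?thesis by simp
  qed
  have scale: "infdist (c *\<^sub>R x) N \<le> c * infdist x N" if "0 < c" for c x
  proof -
    have "infdist (c *\<^sub>R x) N / c \<le> infdist x N"
    proof (rule ge)
      fix a
      assume "a \<in> N"
      then have "infdist (c *\<^sub>R x) N \<le> dist (c *\<^sub>R x) (c *\<^sub>R a)"
        using N by (intro infdist_le) (simp add: subspace_scale)
      also have "\<dots> = c * dist x a"
        using that by (simp add: dist_norm flip: scaleR_diff_right)
      finally show "infdist (c *\<^sub>R x) N / c \<le> dist x a"
        using that by (simp add: field_simps)
    qed
    then show ?thesis using that by (simp add: field_simps)
  qed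
  have "infdist (c *\<^sub>R x) N = c * infdist x N" if "0 \<le> c" for c x
  proof (cases "c = 0")
    case True
    then show ?thesis using subspace_0[OF N] by simp
  next
    case False
    then have "0 < c" using that by simp
    then have "infdist (inverse c *\<^sub>R (c *\<^sub>R x)) N \<le> inverse c * infdist (c *\<^sub>R x) N"
      by (intro scale) simp
    then have "c * infdist x N \<le> infdist (c *\<^sub>R x) N"
      using \<open>0 < c\<close> by (simp add: field_simps)
    then show ?thesis
      using scale[OF \<open>0 < c\<close>, of x] by simp
  qed
  then show ?thesis
    using add by (simp add: sublinear_def)
qed

text \<open>The distance to \<open>N\<close> vanishes on \<open>N\<close>, hence is odd there, and
  is at most the norm because \<open>0 \<in> N\<close>. A linear functional below it inherits both
  properties.\<close>

lemma annihilating_functional_finite_codim: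
  fixes N :: "'a::real_normed_vector set"
  assumes N: "subspace N" and B: "finite B" "span (N \<union> B) = UNIV"
  obtains l where "linear l" "\<And>x. \<bar>l x\<bar> \<le> norm x" "\<And>x. x \<in> N \<Longrightarrow> l x = 0" "l z = infdist z N"
proof -
  have "infdist (- x) N = - infdist x N" if "x \<in> N" for x
    using that subspace_neg[OF N that] by simp
  then obtain l where l: "linear l" "\<And>x. l x \<le> infdist x N" "l z = infdist z N"
    using hahn_banach_finite_codim[OF sublinear_infdist[OF N] _ B] by metis
  have le_norm: "l x \<le> norm x" for x
    using l(2)[of x] infdist_le[OF subspace_0[OF N], of x] by simp
  have "\<bar>l x\<bar> \<le> norm x" for x
    using le_norm[of x] le_norm[of "- x"] linear_neg[OF l(1), of x] by simp
  moreover have "l x = 0" if "x \<in> N" for x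
    using l(2)[of x] l(2)[of "- x"] linear_neg[OF l(1), of x] that subspace_neg[OF N that] by simp
  ultimately show ?thesis
    using that l by blast
qed

section \<open>Measures of finite support representing a functional\<close>

definition fun_subspace :: "('x \<Rightarrow> real) set \<Rightarrow> bool" where
  "fun_subspace V \<longleftrightarrow> (\<lambda>x. 0) \<in> V \<and>
     (\<forall>f\<in>V. \<forall>g\<in>V. \<forall>a b. (\<lambda>x. a * f x + b * g x) \<in> V)"

definition linear_functional_on :: "('x \<Rightarrow> real) set \<Rightarrow> (('x \<Rightarrow> real) \<Rightarrow> real) \<Rightarrow> bool" where
  "linear_functional_on V L \<longleftrightarrow>
     (\<forall>f\<in>V. \<forall>g\<in>V. \<forall>a b. L (\<lambda>x. a * f x + b * g x) = a * L f + b * L g)"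

lemma fun_subspace_combination:
  assumes "fun_subspace V" "f \<in> V" "g \<in> V"
  shows "(\<lambda>x. a * f x + b * g x) \<in> V"
  using assms unfolding fun_subspace_def by blast

lemma fun_subspace_sum:
  assumes V: "fun_subspace V" and "\<And>a. a \<in> A \<Longrightarrow> v a \<in> V"
  shows "(\<lambda>x. \<Sum>a\<in>A. c a * v a x) \<in> V"
  using assms(2)
proof (induction A rule: infinite_finite_induct)
  case (insert a A)
  then show ?case
    using fun_subspace_combination[OF V, of "v a" "\<lambda>x. \<Sum>a\<in>A. c a * v a x" "c a" 1] by simp
qed (use V in \<open>auto simp: fun_subspace_def\<close>)

lemma linear_functional_on_combination:
  assumes "linear_functional_on V L" "f \<in> V" "g \<in> V"
  shows "L (\<lambda>x. a * f x + b * g x) = a * L f + b * L g"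
  using assms by (simp add: linear_functional_on_def)

lemma linear_functional_on_sum:
  assumes V: "fun_subspace V" and L: "linear_functional_on V L" and "\<And>a. a \<in> A \<Longrightarrow> v a \<in> V"
  shows "L (\<lambda>x. \<Sum>a\<in>A. c a * v a x) = (\<Sum>a\<in>A. c a * L (v a))"
proof -
  have "(\<lambda>x. 0) \<in> V"
    using V by (simp add: fun_subspace_def)
  from linear_functional_on_combination[OF L this this, of 0 0] have zero: "L (\<lambda>x. 0) = 0"
    by simp
  show ?thesis
    using assms(3)
  proof (induction A rule: infinite_finite_induct)
    case (insert a A)
    have "(\<lambda>x. \<Sum>a\<in>A. c a * v a x) \<in> V"
      using insert.prems by (intro fun_subspace_sum[OF V]) auto
    from linear_functional_on_combination[OF L insert.prems this, of a "c a" 1]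
    show ?case
      using insert by simp
  qed (simp_all add: zero)
qed

text \<open>Each generator costs at most one new node: the functions expressible without it have
  codimension at most 1 in \<open>V\<close>. The result turns every linear functional on
  \<open>V\<close> into a finite combination of point evaluations.\<close>

lemma finite_dim_interpolation:
  fixes e :: "'i \<Rightarrow> 'x \<Rightarrow> real"
  assumes "finite I" "fun_subspace V"
    and "\<And>f. f \<in> V \<Longrightarrow> \<exists>c. f = (\<lambda>x. \<Sum>i\<in>I. c i * e i x)"
  shows "\<exists>A v. finite A \<and> (\<forall>a\<in>A. v a \<in> V) \<and> (\<forall>f\<in>V. f = (\<lambda>x. \<Sum>a\<in>A. f a * v a x))"
  using assms
proof (induction I arbitrary: V rule: finite_induct)
  case empty
  then show ?case by (intro exI[of _ "{}"]) auto
next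
  case (insert j I)
  note V = \<open>fun_subspace V\<close>
  define W where "W = {f \<in> V. \<exists>c. f = (\<lambda>x. \<Sum>i\<in>I. c i * e i x)}"
  have "(\<lambda>x. a * f x + b * g x) \<in> W" if fg: "f \<in> W" "g \<in> W" for a b f g
  proof -
    obtain c where c: "f = (\<lambda>x. \<Sum>i\<in>I. c i * e i x)"
      using fg(1) unfolding W_def by blast
    obtain d where d: "g = (\<lambda>x. \<Sum>i\<in>I. d i * e i x)"
      using fg(2) unfolding W_def by blast
    have "(\<lambda>x. a * f x + b * g x) = (\<lambda>x. \<Sum>i\<in>I. (a * c i + b * d i) * e i x)"
      by (simp add: c d sum_distrib_left sum.distrib algebra_simps)
    moreover have "(\<lambda>x. a * f x + b * g x) \<in> V"
      using fg by (intro fun_subspace_combination[OF V]) (simp_all add: W_def)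
    ultimately show ?thesis
      unfolding W_def by (intro CollectI conjI exI)
  qed
  moreover have "(\<lambda>x. 0) \<in> W"
    using V unfolding W_def fun_subspace_def by (auto intro!: exI[of _ "\<lambda>_. 0"])
  ultimately have "fun_subspace W"
    by (simp add: fun_subspace_def)
  then obtain A v where A: "finite A" and vW: "\<And>a. a \<in> A \<Longrightarrow> v a \<in> W"
    and W_eq: "\<And>f. f \<in> W \<Longrightarrow> f = (\<lambda>x. \<Sum>a\<in>A. f a * v a x)"
    using insert.IH[of W] W_def by blast
  have vV: "\<And>a. a \<in> A \<Longrightarrow> v a \<in> V"
    using vW unfolding W_def by blast
  show ?case
  proof (cases "V \<subseteq> W")
    case True
    then show ?thesis using A vV W_eq by blast
  next
    case False
    then obtain h where h: "h \<in> V" "h \<notin> W" by blast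
    then obtain c where c: "h = (\<lambda>x. \<Sum>i\<in>insert j I. c i * e i x)"
      using insert.prems(2) by blast
    have cj: "c j \<noteq> 0"
    proof
      assume "c j = 0"
      then have "h = (\<lambda>x. \<Sum>i\<in>I. c i * e i x)"
        using c insert.hyps by simp
      then show False using h unfolding W_def by blast
    qed
    \<comment> \<open>The error of interpolating \<open>h\<close> with the nodes that are exact on
      \<open>W\<close>.\<close>
    define r where "r x = h x - (\<Sum>a\<in>A. h a * v a x)" for x
    have "(\<lambda>x. \<Sum>a\<in>A. h a * v a x) \<in> V"
      by (intro fun_subspace_sum[OF V] vV)
    from fun_subspace_combination[OF V h(1) this, of 1 "-1"] have rV: "r \<in> V"
      by (simp add: r_def[abs_def])
    \<comment> \<open>\<open>V\<close> is \<open>W\<close> plus the line spanned by \<open>h\<close>, so interpolation at \<open>A\<close> leaves a multiple of \<open>r\<close>,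
      which one further node determines (that node may already belong to \<open>A\<close>).\<close>
    have residual: "\<exists>t. \<forall>x. f x - (\<Sum>a\<in>A. f a * v a x) = t * r x" if f: "f \<in> V" for f
    proof -
      obtain d where d: "f = (\<lambda>x. \<Sum>i\<in>insert j I. d i * e i x)"
        using insert.prems(2) f by blast
      \<comment> \<open>Chosen so that \<open>e j\<close> cancels in \<open>f - t h\<close>, which
        therefore lies in \<open>W\<close> and is interpolated exactly.\<close>
      define t where "t = d j / c j"
      define g where "g x = f x - t * h x" for x
      have "g = (\<lambda>x. \<Sum>i\<in>I. (d i - t * c i) * e i x)"
        using insert.hyps cj
        by (simp add: g_def c d t_def fun_eq_iff sum_distrib_left sum_subtractf algebra_simps)
      moreover have "g \<in> V"
        using fun_subspace_combination[OF V f h(1), of 1 "- t"] by (simp add: g_def[abs_def])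
      ultimately have "g \<in> W" unfolding W_def by (intro CollectI conjI exI)
      then have "g x = (\<Sum>a\<in>A. g a * v a x)" for x
        using W_eq by metis
      then have "f x - (\<Sum>a\<in>A. f a * v a x) = t * r x" for x
        by (simp add: g_def r_def sum_distrib_left sum_subtractf algebra_simps)
      then show ?thesis by blast
    qed
    show ?thesis
    proof (cases "\<forall>x. r x = 0")
      case True
      have "f = (\<lambda>x. \<Sum>a\<in>A. f a * v a x)" if f: "f \<in> V" for f
      proof
        fix x
        obtain t where t: "f x - (\<Sum>a\<in>A. f a * v a x) = t * r x"
          using residual[OF f] by auto
        then show "f x = (\<Sum>a\<in>A. f a * v a x)"
          by (simp only: spec[OF True] mult_zero_right right_minus_eq)
      qed
      then show ?thesis
        using A vV by (intro exI conjI ballI)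
    next
      case False
      then obtain y where y: "r y \<noteq> 0" by blast
      \<comment> \<open>Solving \<open>f x - (\<Sum>a\<in>A. f a * v a x) = t * r x\<close> at
        \<open>x = y\<close> for \<open>t\<close>, substituting back and collecting the coefficient
        of each \<open>f a\<close> gives these functions. The two contributions are added, so the
        formula also holds when \<open>y \<in> A\<close>.\<close>
      define w where "w a x = (if a \<in> A then v a x - v a y / r y * r x else 0)
          + (if a = y then r x / r y else 0)" for a x
      have "w a \<in> V" for a
      proof -
        have "(\<lambda>x. if a \<in> A then v a x - v a y / r y * r x else 0) \<in> V"
        proof (cases "a \<in> A")
          case True
          then show ?thesis
            using fun_subspace_combination[OF V vV rV, of a 1 "- (v a y / r y)"] by simp
        qed (use V in \<open>simp add: fun_subspace_def\<close>)
        from fun_subspace_combination[OF V this rV, of 1 "if a = y then 1 / r y else 0"]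
        show ?thesis
          by (rule back_subst[of "\<lambda>f. f \<in> V"]) (simp add: w_def fun_eq_iff)
      qed
      moreover have "f = (\<lambda>x. \<Sum>a\<in>insert y A. f a * w a x)" if f: "f \<in> V" for f
      proof
        fix x
        obtain t where t: "\<And>x. f x - (\<Sum>a\<in>A. f a * v a x) = t * r x"
          using residual[OF f] by auto
        have t_eq: "t = (f y - (\<Sum>a\<in>A. f a * v a y)) / r y"
          using t[of y] y by (simp add: field_simps)
        have "(\<Sum>a\<in>insert y A. f a * w a x)
            = (\<Sum>a\<in>insert y A. if a \<in> A then f a * (v a x - v a y / r y * r x) else 0)
              + (\<Sum>a\<in>insert y A. if a = y then f a * (r x / r y) else 0)"
          by (subst sum.distrib[symmetric], rule sum.cong)
            (auto simp: w_def distrib_left)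
        also have "(\<Sum>a\<in>insert y A. if a \<in> A then f a * (v a x - v a y / r y * r x) else 0)
            = (\<Sum>a\<in>A. f a * (v a x - v a y / r y * r x))"
          using A by (intro sum.mono_neutral_cong_right) auto
        also have "\<dots> = (\<Sum>a\<in>A. f a * v a x) - (\<Sum>a\<in>A. f a * v a y) / r y * r x"
          by (simp add: right_diff_distrib sum_subtractf sum_divide_distrib sum_distrib_right mult.assoc)
        also have "(\<Sum>a\<in>insert y A. if a = y then f a * (r x / r y) else 0) = f y * (r x / r y)"
          using A by simp
        also have "(\<Sum>a\<in>A. f a * v a x) - (\<Sum>a\<in>A. f a * v a y) / r y * r x + f y * (r x / r y)
            = (\<Sum>a\<in>A. f a * v a x) + t * r x"
          by (simp add: t_eq diff_divide_distrib left_diff_distrib)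
        also have "\<dots> = f x"
          using t[of x] by simp
        finally show "f x = (\<Sum>a\<in>insert y A. f a * w a x)" ..
      qed
      ultimately show ?thesis
        using A by (intro exI[of _ "insert y A"] exI[of _ w] conjI ballI) auto
    qed
  qed
qed

section \<open>Integration of functions against finitely supported signed measures\<close>

definition pairing :: "('x \<Rightarrow>\<^sub>0 real) \<Rightarrow> ('x \<Rightarrow> real) \<Rightarrow> real" where
  "pairing \<phi> f = (\<Sum>a\<in>Poly_Mapping.keys \<phi>. Poly_Mapping.lookup \<phi> a * f a)"

lemma pairing_superset:
  assumes "finite A" "Poly_Mapping.keys \<phi> \<subseteq> A"
  shows "pairing \<phi> f = (\<Sum>a\<in>A. Poly_Mapping.lookup \<phi> a * f a)"
  unfolding pairing_def using assms by (intro sum.mono_neutral_left) (auto simp: in_keys_iff)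

lemma lookup_scaleR: "Poly_Mapping.lookup (c *\<^sub>R \<phi>) a = c *\<^sub>R Poly_Mapping.lookup \<phi> a"
  by (simp add: scaleR_poly_mapping_def)

lemma linear_pairing: "linear (\<lambda>\<phi>. pairing \<phi> f)"
proof (rule linearI)
  fix \<phi> \<psi> :: "'a \<Rightarrow>\<^sub>0 real"
  let ?A = "Poly_Mapping.keys \<phi> \<union> Poly_Mapping.keys \<psi>"
  have "pairing (\<phi> + \<psi>) f = (\<Sum>a\<in>?A. Poly_Mapping.lookup (\<phi> + \<psi>) a * f a)"
    by (intro pairing_superset keys_add) simp
  also have "\<dots> = (\<Sum>a\<in>?A. Poly_Mapping.lookup \<phi> a * f a) + (\<Sum>a\<in>?A. Poly_Mapping.lookup \<psi> a * f a)"
    by (simp add: lookup_add distrib_right sum.distrib)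
  also have "\<dots> = pairing \<phi> f + pairing \<psi> f"
    by (simp add: pairing_superset[of ?A])
  finally show "pairing (\<phi> + \<psi>) f = pairing \<phi> f + pairing \<psi> f" .
next
  fix c and \<phi> :: "'a \<Rightarrow>\<^sub>0 real"
  have "pairing (c *\<^sub>R \<phi>) f = (\<Sum>a\<in>Poly_Mapping.keys \<phi>. Poly_Mapping.lookup (c *\<^sub>R \<phi>) a * f a)"
    by (intro pairing_superset) (auto simp: in_keys_iff lookup_scaleR)
  then show "pairing (c *\<^sub>R \<phi>) f = c *\<^sub>R pairing \<phi> f"
    by (simp add: pairing_def lookup_scaleR sum_distrib_left mult.assoc)
qed

lemma pairing_single [simp]: "pairing (Poly_Mapping.single a c) f = c * f a"
  by (simp add: pairing_def)

lemma pairing_sum_single [simp]: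
  "pairing (\<Sum>a\<in>A. c a *\<^sub>R Poly_Mapping.single a 1) f = (\<Sum>a\<in>A. c a * f a)"
  by (simp add: linear_sum[OF linear_pairing] linear_scale[OF linear_pairing])

lemma linear_functional_on_pairing: "linear_functional_on V (pairing \<phi>)"
  by (simp add: linear_functional_on_def pairing_def sum.distrib sum_distrib_left algebra_simps)

lemma poly_mapping_sum_single:
  fixes \<phi> :: "'a \<Rightarrow>\<^sub>0 real"
  shows "\<phi> = (\<Sum>a\<in>Poly_Mapping.keys \<phi>. Poly_Mapping.lookup \<phi> a *\<^sub>R Poly_Mapping.single a 1)"
  by (rule poly_mapping_eqI)
    (auto simp: lookup_sum lookup_scaleR lookup_single when_def in_keys_iff if_distrib cong: if_cong)

text \<open>Dirac measures span, so every linear functional is integration against the function of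
  its values on them.\<close>

lemma linear_eq_pairing:
  assumes "linear l"
  shows "l \<phi> = pairing \<phi> (\<lambda>a. l (Poly_Mapping.single a 1))"
  by (subst poly_mapping_sum_single)
    (simp add: linear_sum[OF assms] linear_scale[OF assms] pairing_def)

lemma norm_poly_mapping_eq_sum:
  "norm \<phi> = (\<Sum>a\<in>Poly_Mapping.keys \<phi>. norm (Poly_Mapping.lookup \<phi> a))"
  by (simp add: norm_poly_mapping_def dist_poly_mapping_def)

lemma pairing_le_norm:
  assumes "\<And>x. \<bar>f x\<bar> \<le> 1"
  shows "pairing \<phi> f \<le> norm \<phi>"
  unfolding pairing_def norm_poly_mapping_eq_sum
proof (rule sum_mono)
  fix a
  have "Poly_Mapping.lookup \<phi> a * f a \<le> \<bar>Poly_Mapping.lookup \<phi> a\<bar> * \<bar>f a\<bar>"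
    by (metis abs_ge_self abs_mult)
  also have "\<dots> \<le> \<bar>Poly_Mapping.lookup \<phi> a\<bar> * 1"
    using assms by (intro mult_left_mono) auto
  finally show "Poly_Mapping.lookup \<phi> a * f a \<le> norm (Poly_Mapping.lookup \<phi> a)" by simp
qed

text \<open>Abstract strong duality: \<open>f\<close> is dual optimal for \<open>L\<close>. The
  measures representing \<open>L\<close> form a coset of the annihilator of \<open>V\<close>, and
  the \<epsilon> reflects that their least norm is obtained as a distance, that is, an
  infimum.\<close>

lemma finite_dim_norming_measures:
  fixes V :: "('x \<Rightarrow> real) set" and e :: "'i \<Rightarrow> 'x \<Rightarrow> real"
  assumes I: "finite I" and V: "fun_subspace V"
    and span: "\<And>f. f \<in> V \<Longrightarrow> \<exists>c. f = (\<lambda>x. \<Sum>i\<in>I. c i * e i x)"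
    and L: "linear_functional_on V L"
  obtains f where "f \<in> V" "\<And>x. \<bar>f x\<bar> \<le> 1"
    "\<And>\<epsilon>. 0 < \<epsilon> \<Longrightarrow> \<exists>\<phi>. (\<forall>g\<in>V. pairing \<phi> g = L g) \<and> norm \<phi> < L f + \<epsilon>"
proof -
  let ?\<delta> = "\<lambda>a. Poly_Mapping.single a (1::real)"
  obtain A v where A: "finite A" and v: "\<And>a. a \<in> A \<Longrightarrow> v a \<in> V"
    and V_eq: "\<And>f. f \<in> V \<Longrightarrow> f = (\<lambda>x. \<Sum>a\<in>A. f a * v a x)"
    using finite_dim_interpolation[OF I V span] by metis
  \<comment> \<open>Used twice: with \<open>K = L\<close> it yields a representing measure, with
    \<open>K\<close> a pairing it yields the finite codimension of \<open>N\<close>.\<close>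
  have functional_eq: "K g = (\<Sum>a\<in>A. K (v a) * g a)" if "linear_functional_on V K" "g \<in> V" for K g
  proof -
    have "K g = K (\<lambda>x. \<Sum>a\<in>A. g a * v a x)"
      using V_eq[OF that(2)] by simp
    also have "\<dots> = (\<Sum>a\<in>A. g a * K (v a))"
      by (rule linear_functional_on_sum[OF V that(1) v])
    finally show ?thesis by (simp add: mult.commute)
  qed
  define N where "N = {\<psi>. \<forall>g\<in>V. pairing \<psi> g = 0}"
  define \<phi>\<^sub>0 where "\<phi>\<^sub>0 = (\<Sum>a\<in>A. L (v a) *\<^sub>R ?\<delta> a)"
  have \<phi>\<^sub>0: "pairing \<phi>\<^sub>0 g = L g" if "g \<in> V" for g
    using functional_eq[OF L that] by (simp add: \<phi>\<^sub>0_def)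
  have N: "subspace N"
    by (rule subspaceI)
      (auto simp: N_def linear_0[OF linear_pairing] linear_add[OF linear_pairing]
        linear_scale[OF linear_pairing])
  \<comment> \<open>Modulo \<open>N\<close>, every measure is a combination of the Dirac measures at
    the nodes.\<close>
  have in_N: "\<psi> - (\<Sum>a\<in>A. pairing \<psi> (v a) *\<^sub>R ?\<delta> a) \<in> N" for \<psi>
    unfolding N_def
  proof (intro CollectI ballI)
    fix g
    assume "g \<in> V"
    then have "pairing \<psi> g = (\<Sum>a\<in>A. pairing \<psi> (v a) * g a)"
      by (rule functional_eq[OF linear_functional_on_pairing])
    then show "pairing (\<psi> - (\<Sum>a\<in>A. pairing \<psi> (v a) *\<^sub>R ?\<delta> a)) g = 0"
      by (simp add: linear_diff[OF linear_pairing])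
  qed
  have "\<psi> \<in> span (N \<union> ?\<delta> ` A)" for \<psi> :: "'x \<Rightarrow>\<^sub>0 real"
  proof -
    have "(\<psi> - (\<Sum>a\<in>A. pairing \<psi> (v a) *\<^sub>R ?\<delta> a)) + (\<Sum>a\<in>A. pairing \<psi> (v a) *\<^sub>R ?\<delta> a)
        \<in> span (N \<union> ?\<delta> ` A)"
      using in_N by (intro span_add span_sum span_scale) (auto intro: span_base)
    then show ?thesis by simp
  qed
  then have "span (N \<union> ?\<delta> ` A) = UNIV" by blast
  then obtain l where l: "linear l" "\<And>\<psi>. \<bar>l \<psi>\<bar> \<le> norm \<psi>" "\<And>\<psi>. \<psi> \<in> N \<Longrightarrow> l \<psi> = 0"
    and l_eq: "l \<phi>\<^sub>0 = infdist \<phi>\<^sub>0 N"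
    using annihilating_functional_finite_codim[OF N] A by (metis finite_imageI)
  define f where "f x = l (?\<delta> x)" for x
  \<comment> \<open>For the Dirac measure at \<open>x\<close>, \<open>in_N\<close> has the
    coefficients \<open>v a x\<close>; since \<open>l\<close> kills \<open>N\<close>, applying it
    expresses \<open>f\<close> through the \<open>v a\<close>, which puts \<open>f\<close> in
    \<open>V\<close>.\<close>
  have "f = (\<lambda>x. \<Sum>a\<in>A. f a * v a x)"
  proof
    fix x
    have "l (?\<delta> x - (\<Sum>a\<in>A. v a x *\<^sub>R ?\<delta> a)) = 0"
      using l(3)[OF in_N[of "?\<delta> x"]] by simp
    then show "f x = (\<Sum>a\<in>A. f a * v a x)"
      by (simp add: f_def linear_diff[OF l(1)] linear_sum[OF l(1)] linear_scale[OF l(1)] mult.commute)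
  qed
  then have "f \<in> V"
    using fun_subspace_sum[OF V, where A = A and c = f and v = v] v by simp
  moreover have "\<bar>f x\<bar> \<le> 1" for x
    using l(2)[of "?\<delta> x"] by (simp add: f_def norm_poly_mapping_eq_sum)
  moreover have "\<exists>\<phi>. (\<forall>g\<in>V. pairing \<phi> g = L g) \<and> norm \<phi> < L f + \<epsilon>" if "0 < \<epsilon>" for \<epsilon>
  proof -
    \<comment> \<open>Both sides equal the pairing of \<open>\<phi>\<^sub>0\<close> with
      \<open>f\<close>: one as \<open>\<phi>\<^sub>0\<close> represents \<open>L\<close>, the other
      as \<open>f\<close> represents \<open>l\<close>.\<close>
    have "L f = infdist \<phi>\<^sub>0 N"
      using \<phi>\<^sub>0[OF \<open>f \<in> V\<close>] linear_eq_pairing[OF l(1), of \<phi>\<^sub>0] l_eq by (simp add: f_def[abs_def])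
    moreover have "N \<noteq> {}"
      using subspace_0[OF N] by blast
    ultimately have "Inf (dist \<phi>\<^sub>0 ` N) < L f + \<epsilon>"
      using that infdist_notempty[of N \<phi>\<^sub>0] by simp
    then obtain \<psi> where \<psi>: "\<psi> \<in> N" "dist \<phi>\<^sub>0 \<psi> < L f + \<epsilon>"
      using cInf_lessD[of "dist \<phi>\<^sub>0 ` N"] subspace_0[OF N] by blast
    then show ?thesis
      using \<phi>\<^sub>0 by (intro exI[of _ "\<phi>\<^sub>0 - \<psi>"]) (auto simp: N_def linear_diff[OF linear_pairing] dist_norm)
  qed
  ultimately show ?thesis
    using that by blast
qed

section \<open>Trigonometric polynomials\<close>

text \<open>Complex-valued and with unrestricted coefficients, so that differentiation becomes
  multiplication of coefficients.\<close>

definition trig_poly :: "(real ^ 'd) set \<Rightarrow> (real ^ 'd \<Rightarrow> complex) \<Rightarrow> real ^ 'd \<Rightarrow> complex" where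
  "trig_poly \<Xi> b x =
     (\<Sum>\<xi>\<in>\<Xi>. b \<xi> * exp (2 * complex_of_real pi * \<i> * complex_of_real (\<xi> \<bullet> x)))"

lemma trig_space_iff:
  "f \<in> trig_space \<Xi> \<longleftrightarrow>
     (\<exists>b. (\<forall>\<xi>\<in>\<Xi>. b (- \<xi>) = cnj (b \<xi>)) \<and> (\<forall>x. complex_of_real (f x) = trig_poly \<Xi> b x))"
  by (simp add: trig_space_def trig_poly_def)

lemma trig_poly_combination:
  "trig_poly \<Xi> (\<lambda>\<xi>. a * b \<xi> + c * d \<xi>) x = a * trig_poly \<Xi> b x + c * trig_poly \<Xi> d x"
  by (simp add: trig_poly_def sum.distrib sum_distrib_left algebra_simps)

lemma fun_subspace_trig_space: "fun_subspace (trig_space \<Xi>)"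
  unfolding fun_subspace_def
proof (intro conjI ballI allI)
  show "(\<lambda>x. 0) \<in> trig_space \<Xi>"
    unfolding trig_space_iff by (intro exI[of _ "\<lambda>_. 0"]) (simp add: trig_poly_def)
next
  fix f g a c
  assume "f \<in> trig_space \<Xi>" "g \<in> trig_space \<Xi>"
  then obtain b d where "\<forall>\<xi>\<in>\<Xi>. b (- \<xi>) = cnj (b \<xi>)" "\<forall>x. complex_of_real (f x) = trig_poly \<Xi> b x"
    "\<forall>\<xi>\<in>\<Xi>. d (- \<xi>) = cnj (d \<xi>)" "\<forall>x. complex_of_real (g x) = trig_poly \<Xi> d x"
    unfolding trig_space_iff by blast
  then show "(\<lambda>x. a * f x + c * g x) \<in> trig_space \<Xi>"
    unfolding trig_space_iff
    by (intro exI[of _ "\<lambda>\<xi>. of_real a * b \<xi> + of_real c * d \<xi>"])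
      (simp add: trig_poly_combination)
qed

text \<open>Taking real parts turns \<open>b \<xi>\<close> into the coefficients
  \<open>Re (b \<xi>)\<close> of the cosine and \<open>- Im (b \<xi>)\<close> of the sine.
  Dependencies between \<xi> and -\<xi> are harmless, as only spanning is claimed.\<close>

lemma trig_space_finite_dim:
  assumes "finite \<Xi>" "f \<in> trig_space \<Xi>"
  shows "\<exists>c. f = (\<lambda>x. \<Sum>i\<in>\<Xi> <+> \<Xi>. c i *
    (case i of Inl \<xi> \<Rightarrow> cos (2 * pi * (\<xi> \<bullet> x)) | Inr \<xi> \<Rightarrow> sin (2 * pi * (\<xi> \<bullet> x))))"
proof -
  obtain b where b: "\<And>x. complex_of_real (f x) = trig_poly \<Xi> b x"
    using assms(2) unfolding trig_space_iff by blast
  have "f x = (\<Sum>i\<in>\<Xi> <+> \<Xi>. (case i of Inl \<xi> \<Rightarrow> Re (b \<xi>) | Inr \<xi> \<Rightarrow> - Im (b \<xi>)) *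
      (case i of Inl \<xi> \<Rightarrow> cos (2 * pi * (\<xi> \<bullet> x)) | Inr \<xi> \<Rightarrow> sin (2 * pi * (\<xi> \<bullet> x))))" for x
  proof -
    have "f x = Re (trig_poly \<Xi> b x)"
      by (simp flip: b)
    then show ?thesis
      using assms(1)
      by (simp add: trig_poly_def sum.Plus Re_exp Im_exp sum_subtractf sum_negf)
  qed
  then show ?thesis
    by (intro exI ext)
qed

section \<open>Partial derivatives as Fourier multipliers\<close>

lemma partial_deriv_trig_poly:
  fixes f :: "real ^ 'd \<Rightarrow> real"
  assumes f: "\<And>x. complex_of_real (f x) = trig_poly \<Xi> b x"
  shows "complex_of_real (partial_deriv j f x)
    = trig_poly \<Xi> (\<lambda>\<xi>. 2 * complex_of_real pi * \<i> * complex_of_real (\<xi> $ j) * b \<xi>) x"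
    (is "_ = ?D")
proof -
  let ?c = "2 * complex_of_real pi * \<i>"
  let ?F = "\<lambda>t. trig_poly \<Xi> b (x + t *\<^sub>R axis j 1)"
  have F: "?F t = (\<Sum>\<xi>\<in>\<Xi>. b \<xi> * exp (?c * (of_real (\<xi> \<bullet> x) + of_real t * of_real (\<xi> $ j))))" for t
    by (simp add: trig_poly_def inner_add_right inner_axis)
  \<comment> \<open>The real parameter \<open>t\<close> is replaced by a complex \<open>z\<close>,
    where the complex derivative rules apply, and then restricted to the real line.\<close>
  have "((\<lambda>z. \<Sum>\<xi>\<in>\<Xi>. b \<xi> * exp (?c * (of_real (\<xi> \<bullet> x) + z * of_real (\<xi> $ j))))
      has_field_derivative ?D) (at (of_real 0))"
    unfolding trig_poly_def
    by (auto intro!: derivative_eq_intros sum.cong)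
  from has_vector_derivative_real_field[OF this]
  have D: "(?F has_vector_derivative ?D) (at 0)"
    unfolding F .
  have "((\<lambda>t. Re (?F t)) has_real_derivative Re ?D) (at 0)"
    using bounded_linear.has_vector_derivative[OF bounded_linear_Re D]
    by (simp add: has_real_derivative_iff_has_vector_derivative)
  then have "((\<lambda>t. f (x + t *\<^sub>R axis j 1)) has_real_derivative Re ?D) (at 0)"
    by (simp flip: f)
  then have Re: "partial_deriv j f x = Re ?D"
    by (simp add: partial_deriv_def DERIV_imp_deriv)
  \<comment> \<open>As \<open>f\<close> is real-valued, this imaginary part is constantly 0, so the
    derivative is real without recourse to a symmetry of \<open>b\<close>.\<close>
  have "((\<lambda>t. Im (?F t)) has_real_derivative Im ?D) (at 0)"
    using bounded_linear.has_vector_derivative[OF bounded_linear_Im D]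
    by (simp add: has_real_derivative_iff_has_vector_derivative)
  then have "((\<lambda>t. 0) has_real_derivative Im ?D) (at 0)"
    by (simp flip: f)
  then have "Im ?D = 0"
    using DERIV_unique DERIV_const by blast
  with Re show ?thesis
    by (simp add: complex_eq_iff)
qed

lemma funpow_partial_deriv_trig_poly:
  assumes "\<And>x. complex_of_real (f x) = trig_poly \<Xi> b x"
  shows "complex_of_real ((partial_deriv j ^^ n) f x)
    = trig_poly \<Xi> (\<lambda>\<xi>. (2 * complex_of_real pi * \<i> * complex_of_real (\<xi> $ j)) ^ n * b \<xi>) x"
proof (induction n arbitrary: x)
  case 0
  then show ?case using assms by simp
next
  case (Suc n)
  show ?case
    using partial_deriv_trig_poly[OF Suc.IH] by (simp add: mult.assoc)
qed

text \<open>The Fourier multiplier of \<open>multi_deriv \<alpha>\<close> at the frequency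
  \<xi>.\<close>

definition symbol :: "nat ^ 'd \<Rightarrow> real ^ 'd \<Rightarrow> complex" where
  "symbol \<alpha> \<xi> = (\<Prod>j\<in>UNIV. (2 * complex_of_real pi * \<i> * complex_of_real (\<xi> $ j)) ^ (\<alpha> $ j))"

lemma symbol_minus: "symbol \<alpha> (- \<xi>) = (- 1) ^ (\<Sum>j\<in>UNIV. \<alpha> $ j) * symbol \<alpha> \<xi>"
proof -
  have "symbol \<alpha> (- \<xi>) = (\<Prod>j\<in>UNIV. (- 1) ^ (\<alpha> $ j) *
      (2 * complex_of_real pi * \<i> * complex_of_real (\<xi> $ j)) ^ (\<alpha> $ j))"
    unfolding symbol_def by (intro prod.cong refl) (simp flip: power_mult_distrib)
  then show ?thesis
    by (simp add: symbol_def prod.distrib power_sum)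
qed

lemma multi_deriv_trig_poly:
  assumes "\<And>x. complex_of_real (f x) = trig_poly \<Xi> b x"
  shows "complex_of_real (multi_deriv \<alpha> f x) = trig_poly \<Xi> (\<lambda>\<xi>. symbol \<alpha> \<xi> * b \<xi>) x"
proof -
  let ?m = "\<lambda>j \<xi>. (2 * complex_of_real pi * \<i> * complex_of_real (\<xi> $ j)) ^ (\<alpha> $ j)"
  \<comment> \<open>Generalised to arbitrary lists of indices for the induction; the product over
    the sorted list is then the product over the index type.\<close>
  have "complex_of_real (foldr (\<lambda>j. partial_deriv j ^^ (\<alpha> $ j)) js f x)
      = trig_poly \<Xi> (\<lambda>\<xi>. prod_list (map (\<lambda>j. ?m j \<xi>) js) * b \<xi>) x" for js x
  proof (induction js arbitrary: x)
    case Nil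
    then show ?case using assms by simp
  next
    case (Cons j js)
    show ?case
      using funpow_partial_deriv_trig_poly[OF Cons.IH] by (simp add: mult.assoc)
  qed
  moreover have "prod_list (map (\<lambda>j. ?m j \<xi>) (sorted_list_of_set UNIV)) = symbol \<alpha> \<xi>" for \<xi>
    unfolding symbol_def by (subst prod.distinct_set_conv_list[symmetric]) simp_all
  ultimately show ?thesis
    by (simp add: multi_deriv_def)
qed

text \<open>The sign is absorbed as a reflection of the frequency, the form that cancels against the
  reflection of the argument below.\<close>

lemma neg_multi_deriv_trig_poly:
  assumes "\<And>x. complex_of_real (f x) = trig_poly \<Xi> b x"
  shows "complex_of_real (neg_multi_deriv \<alpha> f x) = trig_poly \<Xi> (\<lambda>\<xi>. symbol \<alpha> (- \<xi>) * b \<xi>) x"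
proof -
  have "trig_poly \<Xi> (\<lambda>\<xi>. symbol \<alpha> (- \<xi>) * b \<xi>) x
      = (- 1) ^ (\<Sum>j\<in>UNIV. \<alpha> $ j) * trig_poly \<Xi> (\<lambda>\<xi>. symbol \<alpha> \<xi> * b \<xi>) x"
    by (simp add: trig_poly_def symbol_minus sum_distrib_left mult.assoc)
  then show ?thesis
    by (simp add: neg_multi_deriv_def multi_deriv_trig_poly[OF assms])
qed

text \<open>Linearity is read off the coefficients, because \<open>deriv\<close> is a total operator
  that is additive only where derivatives exist.\<close>

lemma linear_functional_on_neg_multi_deriv:
  "linear_functional_on (trig_space \<Xi>) (\<lambda>f. neg_multi_deriv \<alpha> f x)"
  unfolding linear_functional_on_def
proof (intro ballI allI)
  fix f g a c
  assume "f \<in> trig_space \<Xi>" "g \<in> trig_space \<Xi>"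
  then obtain b d where b: "\<And>x. complex_of_real (f x) = trig_poly \<Xi> b x"
    and d: "\<And>x. complex_of_real (g x) = trig_poly \<Xi> d x"
    unfolding trig_space_iff by blast
  have "complex_of_real (a * f x + c * g x)
      = trig_poly \<Xi> (\<lambda>\<xi>. of_real a * b \<xi> + of_real c * d \<xi>) x" for x
    by (simp add: trig_poly_combination b d)
  from neg_multi_deriv_trig_poly[OF this, of \<alpha> x]
  have "complex_of_real (neg_multi_deriv \<alpha> (\<lambda>x. a * f x + c * g x) x)
      = complex_of_real (a * neg_multi_deriv \<alpha> f x + c * neg_multi_deriv \<alpha> g x)"
    by (simp add: neg_multi_deriv_trig_poly[OF b] neg_multi_deriv_trig_poly[OF d]
        trig_poly_combination[symmetric] algebra_simps)
  then show "neg_multi_deriv \<alpha> (\<lambda>x. a * f x + c * g x) x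
      = a * neg_multi_deriv \<alpha> f x + c * neg_multi_deriv \<alpha> g x"
    by (simp only: of_real_eq_iff)
qed

section \<open>Reflection of trigonometric polynomials and feasibility\<close>

lemma sum_symmetric_set:
  assumes "symmetric_set \<Xi>"
  shows "(\<Sum>\<xi>\<in>\<Xi>. h (- \<xi>)) = (\<Sum>\<xi>\<in>\<Xi>. h \<xi>)"
proof -
  have "(\<Sum>\<xi>\<in>uminus ` \<Xi>. h \<xi>) = (\<Sum>\<xi>\<in>\<Xi>. h (- \<xi>))"
    by (subst sum.reindex) (simp_all add: comp_def)
  then show ?thesis
    using assms by (simp add: symmetric_set_def)
qed

lemma trig_space_reflect:
  assumes sym: "symmetric_set \<Xi>" and g: "g \<in> trig_space \<Xi>"
  shows "(\<lambda>y. g (x - y)) \<in> trig_space \<Xi>"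
    and "neg_multi_deriv \<alpha> (\<lambda>y. g (x - y)) 0 = multi_deriv \<alpha> g x"
proof -
  obtain b where herm: "\<And>\<xi>. \<xi> \<in> \<Xi> \<Longrightarrow> b (- \<xi>) = cnj (b \<xi>)"
    and b: "\<And>x. complex_of_real (g x) = trig_poly \<Xi> b x"
    using g unfolding trig_space_iff by blast
  \<comment> \<open>The coefficients of \<open>\<lambda>y. g (x - y)\<close>: reflection exchanges
    \<xi> and -\<xi>, and the translation by \<open>x\<close> becomes a phase.\<close>
  define c where "c \<xi> = b (- \<xi>) * exp (2 * complex_of_real pi * \<i> * complex_of_real (- \<xi> \<bullet> x))" for \<xi>
  have c: "complex_of_real (g (x - y)) = trig_poly \<Xi> c y" for y
  proof -
    have "trig_poly \<Xi> b (x - y)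
        = (\<Sum>\<xi>\<in>\<Xi>. b (- \<xi>) * exp (2 * complex_of_real pi * \<i> * complex_of_real (- \<xi> \<bullet> (x - y))))"
      unfolding trig_poly_def by (rule sum_symmetric_set[OF sym, symmetric])
    also have "\<dots> = trig_poly \<Xi> c y"
      unfolding trig_poly_def c_def
      by (intro sum.cong refl)
        (simp add: inner_diff_right algebra_simps flip: exp_add)
    finally show ?thesis
      by (simp add: b)
  qed
  have "c (- \<xi>) = cnj (c \<xi>)" if "\<xi> \<in> \<Xi>" for \<xi>
  proof -
    \<comment> \<open>Conjugate symmetry of \<open>b\<close> is known only on \<Xi>, and it is
      applied at -\<xi>.\<close>
    have "- \<xi> \<in> \<Xi>"
      using sym that unfolding symmetric_set_def by blast
    then show ?thesis
      using herm[of "- \<xi>"] by (simp add: c_def exp_cnj)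
  qed
  with c show "(\<lambda>y. g (x - y)) \<in> trig_space \<Xi>"
    unfolding trig_space_iff by blast
  have "complex_of_real (neg_multi_deriv \<alpha> (\<lambda>y. g (x - y)) 0)
      = (\<Sum>\<xi>\<in>\<Xi>. symbol \<alpha> (- \<xi>) * b (- \<xi>) *
          exp (2 * complex_of_real pi * \<i> * complex_of_real (- \<xi> \<bullet> x)))"
    by (simp add: neg_multi_deriv_trig_poly[OF c] trig_poly_def c_def mult.assoc)
  also have "\<dots> = trig_poly \<Xi> (\<lambda>\<xi>. symbol \<alpha> \<xi> * b \<xi>) x"
    unfolding trig_poly_def by (rule sum_symmetric_set[OF sym])
  also have "\<dots> = complex_of_real (multi_deriv \<alpha> g x)"
    by (simp add: multi_deriv_trig_poly[OF b])
  finally show "neg_multi_deriv \<alpha> (\<lambda>y. g (x - y)) 0 = multi_deriv \<alpha> g x"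
    by (simp only: of_real_eq_iff)
qed

text \<open>Convolution at \<open>x\<close> is the pairing with the reflected translate of
  \<open>g\<close>, and reflection turns \<open>multi_deriv\<close> at \<open>x\<close> into
  \<open>neg_multi_deriv\<close> at 0. An identity between functions thus becomes one between
  functionals.\<close>

lemma primal_feasible_iff:
  assumes sym: "symmetric_set \<Xi>"
  shows "\<phi> \<in> primal_feasible \<Xi> \<alpha> \<longleftrightarrow>
    (\<forall>f\<in>trig_space \<Xi>. pairing \<phi> f = neg_multi_deriv \<alpha> f 0)"
proof
  assume feasible: "\<phi> \<in> primal_feasible \<Xi> \<alpha>"
  show "\<forall>f\<in>trig_space \<Xi>. pairing \<phi> f = neg_multi_deriv \<alpha> f 0"
  proof
    fix f
    assume "f \<in> trig_space \<Xi>"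
    \<comment> \<open>Reflecting twice returns \<open>f\<close>; \<open>0 - y\<close> matches
      \<open>trig_space_reflect\<close> at \<open>x = 0\<close>.\<close>
    define g where "g y = f (0 - y)" for y
    have g: "g \<in> trig_space \<Xi>"
      using trig_space_reflect(1)[OF sym \<open>f \<in> trig_space \<Xi>\<close>, of 0] by (simp add: g_def[abs_def])
    have "pairing \<phi> f = shift_conv \<phi> g 0"
      by (simp add: pairing_def shift_conv_def g_def)
    also have "\<dots> = multi_deriv \<alpha> g 0"
      using feasible g by (simp add: primal_feasible_def)
    also have "\<dots> = neg_multi_deriv \<alpha> f 0"
      using trig_space_reflect(2)[OF sym g, of \<alpha> 0] by (simp add: g_def)
    finally show "pairing \<phi> f = neg_multi_deriv \<alpha> f 0" .
  qed
next
  assume pairing: "\<forall>f\<in>trig_space \<Xi>. pairing \<phi> f = neg_multi_deriv \<alpha> f 0"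
  have "shift_conv \<phi> g x = multi_deriv \<alpha> g x" if g: "g \<in> trig_space \<Xi>" for g x
  proof -
    have "shift_conv \<phi> g x = pairing \<phi> (\<lambda>y. g (x - y))"
      by (simp add: pairing_def shift_conv_def)
    also have "\<dots> = multi_deriv \<alpha> g x"
      using pairing trig_space_reflect[OF sym g] by simp
    finally show ?thesis .
  qed
  then show "\<phi> \<in> primal_feasible \<Xi> \<alpha>"
    by (auto simp: primal_feasible_def)
qed

section \<open>Strong duality for shift rules\<close>

lemma shift_cost_eq_norm: "shift_cost \<phi> = norm \<phi>"
  by (simp add: shift_cost_def norm_poly_mapping_eq_sum)

lemma dual_feasible_iff:
  "f \<in> dual_feasible \<Xi> \<longleftrightarrow> f \<in> trig_space \<Xi> \<and> (\<forall>x. \<bar>f x\<bar> \<le> 1)"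
  by (simp add: dual_feasible_def sup_norm_def SUP_le_iff one_ereal_def)

theorem theorem7:
  fixes \<Xi> :: "(real ^ 'd::{finite,linorder}) set"
    and \<alpha> :: "nat ^ 'd::{finite,linorder}"
  assumes "finite \<Xi>"
    and "symmetric_set \<Xi>"
    and "\<forall>j. 1 \<le> \<alpha> $ j"
  shows "(\<exists>m. is_maximum {neg_multi_deriv \<alpha> f 0 | f. f \<in> dual_feasible \<Xi>} m \<and>
              primal_value \<Xi> \<alpha> = ereal m) \<and>
         (\<forall>\<phi>. primal_optimal \<Xi> \<alpha> \<phi> \<longrightarrow>
              (\<exists>f\<in>dual_feasible \<Xi>. shift_cost \<phi> = neg_multi_deriv \<alpha> f 0))"
proof -
  note feasible_iff = primal_feasible_iff[OF assms(2)]
  \<comment> \<open>Weak duality: the dual value is the pairing of \<phi> with \<open>g\<close>,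
    which is at most the norm of \<phi> because \<open>g\<close> is bounded by 1.\<close>
  have weak: "neg_multi_deriv \<alpha> g 0 \<le> shift_cost \<phi>"
    if "g \<in> dual_feasible \<Xi>" "\<phi> \<in> primal_feasible \<Xi> \<alpha>" for g \<phi>
    using that pairing_le_norm[of g \<phi>]
    by (simp add: dual_feasible_iff feasible_iff shift_cost_eq_norm)
  \<comment> \<open>Abstract duality for the functional \<open>neg_multi_deriv \<alpha> f 0\<close>,
    with the cosines and sines indexed by two copies of \<Xi> as generators.\<close>
  obtain f where f: "f \<in> dual_feasible \<Xi>" and approx: "\<And>\<epsilon>. 0 < \<epsilon> \<Longrightarrow>
      \<exists>\<phi>\<in>primal_feasible \<Xi> \<alpha>. shift_cost \<phi> < neg_multi_deriv \<alpha> f 0 + \<epsilon>"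
    using finite_dim_norming_measures[OF finite_Plus[OF assms(1,1)] fun_subspace_trig_space
        trig_space_finite_dim[OF assms(1)] linear_functional_on_neg_multi_deriv]
    unfolding dual_feasible_iff Bex_def feasible_iff shift_cost_eq_norm by metis
  have value_eq: "primal_value \<Xi> \<alpha> = ereal (neg_multi_deriv \<alpha> f 0)"
  proof (rule antisym)
    show "primal_value \<Xi> \<alpha> \<le> ereal (neg_multi_deriv \<alpha> f 0)"
    proof (rule ereal_le_epsilon2)
      fix \<epsilon> :: real
      assume "0 < \<epsilon>"
      then obtain \<phi> where \<phi>: "\<phi> \<in> primal_feasible \<Xi> \<alpha>"
        "shift_cost \<phi> < neg_multi_deriv \<alpha> f 0 + \<epsilon>"
        using approx by blast
      then show "primal_value \<Xi> \<alpha> \<le> ereal (neg_multi_deriv \<alpha> f 0) + ereal \<epsilon>"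
        unfolding primal_value_def by (intro INF_lower2[of \<phi>]) auto
    qed
    show "ereal (neg_multi_deriv \<alpha> f 0) \<le> primal_value \<Xi> \<alpha>"
      unfolding primal_value_def using weak[OF f] by (intro INF_greatest) simp
  qed
  have "neg_multi_deriv \<alpha> g 0 \<le> neg_multi_deriv \<alpha> f 0" if "g \<in> dual_feasible \<Xi>" for g
  proof -
    have "ereal (neg_multi_deriv \<alpha> g 0) \<le> primal_value \<Xi> \<alpha>"
      unfolding primal_value_def using weak[OF that] by (intro INF_greatest) simp
    then show ?thesis by (simp add: value_eq)
  qed
  then have "is_maximum {neg_multi_deriv \<alpha> g 0 | g. g \<in> dual_feasible \<Xi>} (neg_multi_deriv \<alpha> f 0)"
    using f unfolding is_maximum_def by blast
  moreover have "shift_cost \<phi> = neg_multi_deriv \<alpha> f 0" if "primal_optimal \<Xi> \<alpha> \<phi>" for \<phi>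
    using that by (simp add: primal_optimal_def value_eq)
  ultimately show ?thesis
    using value_eq f by blast
qed

end
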